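(* Let $R$ be a proper $*$-ring, let $a\in R$ and let $m$ be a positive integer. The following assertions are equivalent: (i) $a$ is weak core invertible and $\mathrm{ind}_{wc}(a)\le m$; (ii) there is an idempotent $p\in R$ such that $a^mR=a^{m+1}R=pR$, $Ra^m\subseteq Ra^{m+1}$ and $R(a^m)^*\subseteq Rp$; (iii) $a^{m+1}$ has an inner inverse, and there is an idempotent $p\in R$ such that ${}^{\circ}p={}^{\circ}(a^m)={}^{\circ}(a^{m+1})$, $(a^{m+1})^{\circ}\subseteq (a^m)^{\circ}$ and $p^{\circ}\subseteq ((a^m)^* )^{\circ}$. If these assertions hold, then (ii) and (iii) are satisfied by the same unique idempotent $p$. Furthermore, $a^m(a^{m+1})^{(1)}p$ does not depend on the choice of the inner inverse $(a^{m+1})^{(1)}$ of $a^{m+1}$, and $a^{\boxplus}=a^m(a^{m+1})^{(1)}p$.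
   Context: A proper $*$-ring is a (not necessarily commutative) ring $R$ with unit $1\ne 0$ and an involution $r\mapsto r^*$ satisfying $(r^* )^*=r$, $(r+s)^*=r^*+s^*$, $(rs)^*=s^*r^*$, such that $r^*r=0$ implies $r=0$. Notation: $aR=\{az: z\in R\}$, $Ra=\{za:z\in R\}$; the left annihilator of $a$ is ${}^{\circ}a=\{z\in R: za=0\}$ and the right annihilator is $a^{\circ}=\{z\in R: az=0\}$. An inner inverse of $b\in R$ is an element $b^{(1)}\in R$ with $b\,b^{(1)}b=b$. An idempotent is an element $p$ with $p^2=p$ (not necessarily $p^*=p$). An element $y\in R$ is a weak core inverse of $a\in R$ if for some positive integer $k$ one has $ya^{k+1}=a^k$, $ay^2=y$ and $(a^k)^*ay=(a^k)^*$. In a proper $*$-ring it is unique if it exists and is denoted $a^{\boxplus}$; $a$ is then called weak core invertible. The smallest positive integer $k$ for which these three equations hold is the weak core index $\mathrm{ind}_{wc}(a)$. *)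

theory Defs
  imports Main
begin

class proper_star_ring = ring_1 +
  fixes star :: "'a \<Rightarrow> 'a"
  assumes star_star: "star (star r) = r"
    and star_add: "star (r + s) = star r + star s"
    and star_mult: "star (r * s) = star s * star r"
    and star_proper: "star r * r = 0 \<Longrightarrow> r = 0"

definition right_ideal :: "'a::ring_1 \<Rightarrow> 'a set"
  where "right_ideal a = {a * z | z. True}"

definition left_ideal :: "'a::ring_1 \<Rightarrow> 'a set"
  where "left_ideal a = {z * a | z. True}"

definition left_annihilator :: "'a::ring_1 \<Rightarrow> 'a set"
  where "left_annihilator a = {z. z * a = 0}"

definition right_annihilator :: "'a::ring_1 \<Rightarrow> 'a set"
  where "right_annihilator a = {z. a * z = 0}"

definition is_inner_inverse :: "'a::ring_1 \<Rightarrow> 'a \<Rightarrow> bool"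
  where "is_inner_inverse b x \<longleftrightarrow> b * x * b = b"

definition idempotent :: "'a::ring_1 \<Rightarrow> bool"
  where "idempotent p \<longleftrightarrow> p ^ 2 = p"

definition wc_equations :: "'a::proper_star_ring \<Rightarrow> 'a \<Rightarrow> nat \<Rightarrow> bool"
  where "wc_equations a y k \<longleftrightarrow>
    y * a ^ (k + 1) = a ^ k \<and> a * y ^ 2 = y \<and> star (a ^ k) * a * y = star (a ^ k)"

definition is_weak_core_inverse :: "'a::proper_star_ring \<Rightarrow> 'a \<Rightarrow> bool"
  where "is_weak_core_inverse a y \<longleftrightarrow> (\<exists>k>0. wc_equations a y k)"

definition weak_core_invertible :: "'a::proper_star_ring \<Rightarrow> bool"
  where "weak_core_invertible a \<longleftrightarrow> (\<exists>y. is_weak_core_inverse a y)"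

(* Unspecified unless a is weak core invertible; see weak_core_inverse_unique below. *)
definition weak_core_inverse :: "'a::proper_star_ring \<Rightarrow> 'a"
  where "weak_core_inverse a = (THE y. is_weak_core_inverse a y)"

(* Unspecified unless a is weak core invertible. *)
definition weak_core_index :: "'a::proper_star_ring \<Rightarrow> nat"
  where "weak_core_index a = (LEAST k. 0 < k \<and> wc_equations a (weak_core_inverse a) k)"

definition wc_ideal_conditions :: "'a::proper_star_ring \<Rightarrow> nat \<Rightarrow> 'a \<Rightarrow> bool"
  where "wc_ideal_conditions a m p \<longleftrightarrow>
    idempotent p \<and>
    right_ideal (a ^ m) = right_ideal (a ^ (m + 1)) \<and>
    right_ideal (a ^ (m + 1)) = right_ideal p \<and>
    left_ideal (a ^ m) \<subseteq> left_ideal (a ^ (m + 1)) \<and>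
    left_ideal (star (a ^ m)) \<subseteq> left_ideal p"

definition wc_annihilator_conditions :: "'a::proper_star_ring \<Rightarrow> nat \<Rightarrow> 'a \<Rightarrow> bool"
  where "wc_annihilator_conditions a m p \<longleftrightarrow>
    idempotent p \<and>
    left_annihilator p = left_annihilator (a ^ m) \<and>
    left_annihilator (a ^ m) = left_annihilator (a ^ (m + 1)) \<and>
    right_annihilator (a ^ (m + 1)) \<subseteq> right_annihilator (a ^ m) \<and>
    right_annihilator p \<subseteq> right_annihilator (star (a ^ m))"

lemma wc_equations_add:
  assumes "wc_equations a y k"
  shows "wc_equations a y (k + j)"
proof -
  have 1: "y * a ^ (k + 1) = a ^ k" and 2: "a * y ^ 2 = y"
    and 3: "star (a ^ k) * a * y = star (a ^ k)"
    using assms by (auto simp: wc_equations_def)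
  have "y * a ^ (k + j + 1) = y * a ^ (k + 1 + j)"
    by (simp add: add.commute)
  also have "\<dots> = y * a ^ (k + 1) * a ^ j"
    by (simp only: power_add[of a "k + 1" j] mult.assoc)
  also have "\<dots> = a ^ (k + j)"
    unfolding 1 by (simp only: power_add)
  finally have 4: "y * a ^ (k + j + 1) = a ^ (k + j)" .
  have "star (a ^ (k + j)) * a * y = star (a ^ j) * (star (a ^ k) * a * y)"
    by (simp add: power_add star_mult mult.assoc)
  also have "\<dots> = star (a ^ (k + j))"
    by (simp only: 3 power_add star_mult)
  finally show ?thesis using 2 4 by (simp add: wc_equations_def)
qed

lemma wc_equations_range:
  assumes "wc_equations a y k"
  shows "y = a ^ j * y ^ (j + 1)"
proof (induction j)
  case (Suc j)
  have 2: "a * y ^ 2 = y" using assms by (auto simp: wc_equations_def)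
  have "a ^ Suc j * y ^ (Suc j + 1) = a ^ j * ((a * y ^ 2) * y ^ j)"
    by (simp add: power2_eq_square mult.assoc power_Suc2[of a] del: power_Suc) (simp add: mult.assoc)
  also have "\<dots> = a ^ j * y ^ (j + 1)" by (simp add: 2)
  finally show ?case using Suc.IH by simp
qed simp

lemma wc_equations_unique:
  assumes y: "wc_equations a y k" and z: "wc_equations a z k"
  shows "y = z"
proof -
  have 1: "y * a ^ (k + 1) = a ^ k"
    and 3: "star (a ^ k) * a * y = star (a ^ k)" "star (a ^ k) * a * z = star (a ^ k)"
    using y z by (auto simp: wc_equations_def)
  define u v where "u = y ^ (k + 1)" and "v = z ^ (k + 1)"
  have u: "y = a ^ k * u" and v: "z = a ^ k * v"
    unfolding u_def v_def by (rule wc_equations_range[OF y] wc_equations_range[OF z])+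
  have comm: "a * (a ^ k * t) = a ^ k * (a * t)" for t
    by (simp only: mult.assoc[symmetric] power_commutes)
  define w where "w = a * u - a * v"
  have ay: "a * (y - z) = a ^ k * w"
    by (simp only: u v w_def right_diff_distrib comm)
  have "star (a ^ k) * (a * (y - z)) = 0"
    using 3 by (simp add: right_diff_distrib mult.assoc)
  hence "star (a ^ k * w) * (a ^ k * w) = 0"
    by (simp add: ay star_mult mult.assoc)
  hence "a * (y - z) = 0" using ay star_proper by simp
  hence eq: "a * y = a * z" by (simp add: right_diff_distrib)
  have cancel: "y * (a * (a ^ k * t)) = a ^ k * t" for t
    using 1 by (simp add: mult.assoc[symmetric])
  have "y = y * (a * y)" using cancel[of u] u by simp
  also have "\<dots> = z" using cancel[of v] v eq by simp
  finally show ?thesis .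
qed

lemma weak_core_inverse_unique:
  assumes "is_weak_core_inverse a y" "is_weak_core_inverse a z"
  shows "y = z"
proof -
  obtain k l where "wc_equations a y k" "wc_equations a z l"
    using assms by (auto simp: is_weak_core_inverse_def)
  hence "wc_equations a y (k + l)" "wc_equations a z (k + l)"
    using wc_equations_add[of a y k l] wc_equations_add[of a z l k] by (simp_all add: add.commute)
  thus ?thesis by (rule wc_equations_unique)
qed

end

theory Submission
  imports Defs
begin

text \<open>
  The idempotent behind both characterisations is \<open>p = a * y\<close>, where \<open>y\<close> is the weak core inverse
  of \<open>a\<close>. Since the weak core equations persist when the exponent grows, assertion (i) amounts to
  their solvability with the exponent \<open>m\<close> itself (\<open>weak_core_index_le_iff\<close>).

  If \<open>y\<close> is a solution, then \<open>y = a^j * y^(j+1)\<close> for every \<open>j\<close>. This makes \<open>p\<close> a right multiple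
  of \<open>a^(m+1)\<close>, and shows that \<open>y\<close> is an outer inverse of \<open>a\<close>, so that \<open>p\<close> is idempotent.
  Properness gives \<open>p * a^m = a^m\<close>: the equation \<open>star (a^m) * p = star (a^m)\<close> says
  that the defect \<open>p * a^m - a^m\<close>, a right multiple of \<open>a^m\<close>, is orthogonal to \<open>a^m\<close> and hence to
  itself. This gives the ideal conditions (\<open>wc_equations_imp_ideal\<close>).

  Ideal inclusions turn into annihilator inclusions with the same \<open>p\<close>, and \<open>p\<close> supplies an inner
  inverse of \<open>a^(m+1)\<close> (\<open>wc_ideal_imp_annihilator\<close>, \<open>wc_ideal_imp_inner_inverse\<close>).

  For the way back, an inner inverse \<open>x\<close> of \<open>c = a^(m+1)\<close> turns annihilator inclusions into
  factorisations: \<open>1 - c * x\<close> kills \<open>c\<close> from the left and so kills \<open>p\<close>, while \<open>1 - x * c\<close> is killed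
  by \<open>c\<close> and so by \<open>a^m\<close>. Then \<open>y = a^m * x * p\<close> satisfies \<open>a * y = c * x * p = p\<close>, from which
  the weak core equations can be read off (\<open>wc_annihilator_imp_equations\<close>). The identity \<open>p = a * y\<close>
  and the uniqueness of \<open>y\<close> give the uniqueness of \<open>p\<close> and the independence of the choice of \<open>x\<close>.
\<close>

section \<open>Ideals, annihilators and inner inverses\<close>

lemma idempotent_iff: "idempotent p \<longleftrightarrow> p * p = p"
  by (simp add: idempotent_def power2_eq_square)

lemma mem_right_ideal_self: "a \<in> right_ideal a"
  unfolding right_ideal_def by (auto intro: exI[of _ 1])

lemma mem_left_ideal_self: "a \<in> left_ideal a"
  unfolding left_ideal_def by (auto intro: exI[of _ 1])

lemma right_ideal_subset_iff: "right_ideal a \<subseteq> right_ideal b \<longleftrightarrow> (\<exists>t. a = b * t)"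
proof
  assume "right_ideal a \<subseteq> right_ideal b"
  then show "\<exists>t. a = b * t"
    using mem_right_ideal_self[of a] unfolding right_ideal_def by auto
next
  assume "\<exists>t. a = b * t"
  then show "right_ideal a \<subseteq> right_ideal b"
    unfolding right_ideal_def by (auto simp: mult.assoc)
qed

lemma left_ideal_subset_iff: "left_ideal a \<subseteq> left_ideal b \<longleftrightarrow> (\<exists>t. a = t * b)"
proof
  assume "left_ideal a \<subseteq> left_ideal b"
  then show "\<exists>t. a = t * b"
    using mem_left_ideal_self[of a] unfolding left_ideal_def by auto
next
  assume "\<exists>t. a = t * b"
  then obtain t where "a = t * b" ..
  then have "z * a = (z * t) * b" for z
    by (simp add: mult.assoc)
  then show "left_ideal a \<subseteq> left_ideal b"
    unfolding left_ideal_def by blast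
qed

lemma left_annihilator_antimono:
  assumes "right_ideal a \<subseteq> right_ideal b"
  shows "left_annihilator b \<subseteq> left_annihilator a"
proof -
  obtain t where "a = b * t"
    using assms right_ideal_subset_iff by blast
  then show ?thesis
    by (auto simp: left_annihilator_def mult.assoc[symmetric])
qed

lemma right_annihilator_antimono:
  assumes "left_ideal a \<subseteq> left_ideal b"
  shows "right_annihilator b \<subseteq> right_annihilator a"
proof -
  obtain t where "a = t * b"
    using assms left_ideal_subset_iff by blast
  then show ?thesis
    by (auto simp: right_annihilator_def mult.assoc)
qed

text \<open>
  Without von Neumann regularity, annihilator inclusions do not imply ideal inclusions. The
  following two lemmas are the partial converses of the two antitonicity laws that an inner
  inverse of \<open>c\<close> provides; idempotents are covered too, since they are their own inner inverses.
\<close>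

lemma left_annihilator_subset_imp:
  assumes "is_inner_inverse c x" and "left_annihilator c \<subseteq> left_annihilator b"
  shows "c * x * b = b"
proof -
  have "1 - c * x \<in> left_annihilator c"
    using assms(1) by (simp add: left_annihilator_def is_inner_inverse_def left_diff_distrib)
  then have "1 - c * x \<in> left_annihilator b"
    using assms(2) by blast
  then show ?thesis
    by (simp add: left_annihilator_def left_diff_distrib)
qed

lemma right_annihilator_subset_imp:
  assumes "is_inner_inverse c x" and "right_annihilator c \<subseteq> right_annihilator b"
  shows "b * x * c = b"
proof -
  have "1 - x * c \<in> right_annihilator c"
    using assms(1)
    by (simp add: right_annihilator_def is_inner_inverse_def right_diff_distrib mult.assoc)
  then have "1 - x * c \<in> right_annihilator b"
    using assms(2) by blast
  then show ?thesis
    by (simp add: right_annihilator_def right_diff_distrib mult.assoc)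
qed

lemma idempotent_imp_inner_inverse: "idempotent p \<Longrightarrow> is_inner_inverse p p"
  by (simp add: idempotent_iff is_inner_inverse_def)

section \<open>The weak core equations and the index\<close>

lemma weak_core_inverse_eqI:
  assumes "0 < m" and "wc_equations a y m"
  shows "weak_core_inverse a = y"
proof -
  have "is_weak_core_inverse a y"
    using assms unfolding is_weak_core_inverse_def by blast
  then show ?thesis
    unfolding weak_core_inverse_def
    by (rule the_equality) (rule weak_core_inverse_unique[OF _ \<open>is_weak_core_inverse a y\<close>])
qed

text \<open>
  Since the equations persist for larger exponents, the bound on the least exponent can be traded
  for the equations at the exponent \<open>m\<close>.
\<close>

lemma weak_core_index_le_iff:
  assumes "0 < m"
  shows "weak_core_invertible a \<and> weak_core_index a \<le> m \<longleftrightarrow> (\<exists>y. wc_equations a y m)"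
proof
  assume *: "weak_core_invertible a \<and> weak_core_index a \<le> m"
  then obtain y k where "0 < k" "wc_equations a y k"
    unfolding weak_core_invertible_def is_weak_core_inverse_def by blast
  then have "0 < k \<and> wc_equations a (weak_core_inverse a) k"
    using weak_core_inverse_eqI by blast
  then have "wc_equations a (weak_core_inverse a) (weak_core_index a)"
    unfolding weak_core_index_def by (rule LeastI2) simp
  then have "wc_equations a (weak_core_inverse a) (weak_core_index a + (m - weak_core_index a))"
    by (rule wc_equations_add)
  then show "\<exists>y. wc_equations a y m"
    using * by auto
next
  assume "\<exists>y. wc_equations a y m"
  then obtain y where y: "wc_equations a y m" ..
  then have "weak_core_invertible a"
    using assms unfolding weak_core_invertible_def is_weak_core_inverse_def by blast
  moreover have "weak_core_index a \<le> m"
    unfolding weak_core_index_def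
    using assms y weak_core_inverse_eqI[OF assms y] by (intro Least_le) simp
  ultimately show "weak_core_invertible a \<and> weak_core_index a \<le> m" ..
qed

lemma wc_equations_outer_inverse:
  assumes "wc_equations a y m"
  shows "y * a * y = y"
proof -
  have y: "y = a ^ m * y ^ (m + 1)"
    by (rule wc_equations_range[OF assms])
  have "y * a * y = y * a * (a ^ m * y ^ (m + 1))"
    by (subst (2) y) (rule refl)
  also have "\<dots> = (y * a ^ (m + 1)) * y ^ (m + 1)"
    by (simp add: mult.assoc)
  also have "\<dots> = a ^ m * y ^ (m + 1)"
    using assms by (simp add: wc_equations_def)
  also note y[symmetric]
  finally show ?thesis .
qed

text \<open>
  In a proper ring, an element of the right ideal of \<open>b\<close> that is orthogonal to \<open>b\<close> is orthogonal
  to itself, hence zero.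
\<close>

lemma star_orthogonal_imp_zero:
  fixes b :: "'a::proper_star_ring"
  assumes "star b * (b * t) = 0"
  shows "b * t = 0"
proof (rule star_proper)
  show "star (b * t) * (b * t) = 0"
    using assms by (simp add: star_mult mult.assoc)
qed

text \<open>
  The third weak core equation makes \<open>a * y\<close> fix \<open>star (a^m)\<close> from the right. Properness turns this
  into fixing \<open>a^m\<close> from the left; for a self-adjoint \<open>a * y\<close> it would be enough
  to apply the involution, but \<open>a * y\<close> is an oblique idempotent in general.
\<close>

lemma wc_equations_fix_power:
  assumes "wc_equations a y m"
  shows "a * y * a ^ m = a ^ m"
proof -
  define t where "t = a * y ^ (m + 1) * a ^ m - 1"
  have "a * y = a * (a ^ m * y ^ (m + 1))"
    by (rule arg_cong[OF wc_equations_range[OF assms]])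
  also have "\<dots> = a ^ m * (a * y ^ (m + 1))"
    by (simp only: mult.assoc[symmetric] power_commutes)
  finally have t: "a ^ m * t = a * y * a ^ m - a ^ m"
    by (simp add: t_def right_diff_distrib mult.assoc)
  have "star (a ^ m) * a * y = star (a ^ m)"
    using assms by (simp add: wc_equations_def)
  then have "star (a ^ m) * (a * y * a ^ m) = star (a ^ m) * a ^ m"
    by (simp only: mult.assoc[symmetric])
  then have "star (a ^ m) * (a ^ m * t) = 0"
    by (simp add: t right_diff_distrib)
  then have "a ^ m * t = 0"
    by (rule star_orthogonal_imp_zero)
  then show ?thesis
    by (simp add: t)
qed

section \<open>The three characterisations\<close>

lemma wc_equations_imp_ideal:
  assumes "wc_equations a y m"
  shows "wc_ideal_conditions a m (a * y)"
proof -
  have 1: "y * a ^ (m + 1) = a ^ m" and 3: "star (a ^ m) * (a * y) = star (a ^ m)"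
    using assms by (simp_all add: wc_equations_def mult.assoc)
  have "a * y * (a * y) = a * (y * a * y)"
    by (simp add: mult.assoc)
  then have "idempotent (a * y)"
    using wc_equations_outer_inverse[OF assms] by (simp add: idempotent_iff)
  moreover have "right_ideal (a ^ m) \<subseteq> right_ideal (a * y)"
    using wc_equations_fix_power[OF assms] right_ideal_subset_iff by metis
  moreover have "a * y = a ^ (m + 1) * y ^ (m + 1)"
    using arg_cong[OF wc_equations_range[OF assms, of m], of "\<lambda>z. a * z"] by (simp add: mult.assoc)
  then have "right_ideal (a * y) \<subseteq> right_ideal (a ^ (m + 1))"
    using right_ideal_subset_iff by blast
  moreover have "a ^ (m + 1) = a ^ m * a"
    by (simp add: power_commutes)
  then have "right_ideal (a ^ (m + 1)) \<subseteq> right_ideal (a ^ m)"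
    using right_ideal_subset_iff by blast
  moreover have "left_ideal (a ^ m) \<subseteq> left_ideal (a ^ (m + 1))"
    using 1 left_ideal_subset_iff by metis
  moreover have "left_ideal (star (a ^ m)) \<subseteq> left_ideal (a * y)"
    using 3 left_ideal_subset_iff by metis
  ultimately show ?thesis
    unfolding wc_ideal_conditions_def by blast
qed

lemma wc_ideal_imp_annihilator:
  assumes "wc_ideal_conditions a m p"
  shows "wc_annihilator_conditions a m p"
proof -
  have "right_ideal p = right_ideal (a ^ m)" "right_ideal (a ^ m) = right_ideal (a ^ (m + 1))"
    using assms by (simp_all add: wc_ideal_conditions_def)
  then have "left_annihilator p = left_annihilator (a ^ m)"
    and "left_annihilator (a ^ m) = left_annihilator (a ^ (m + 1))"
    by (intro equalityI left_annihilator_antimono; simp)+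
  with assms show ?thesis
    by (simp add: wc_ideal_conditions_def wc_annihilator_conditions_def right_annihilator_antimono)
qed

text \<open>
  An element generating the same right ideal as an idempotent is von Neumann regular: any \<open>t\<close> with
  \<open>p = c * t\<close> is an inner inverse of \<open>c\<close>, because \<open>p\<close> fixes \<open>c\<close> from the left.
\<close>

lemma right_ideal_eq_idempotent_imp_inner_inverse:
  assumes "idempotent p" and "right_ideal c = right_ideal p"
  shows "\<exists>x. is_inner_inverse c x"
proof -
  obtain t where t: "p = c * t"
    using assms(2) right_ideal_subset_iff[of p c] by auto
  obtain s where s: "c = p * s"
    using assms(2) right_ideal_subset_iff[of c p] by auto
  have "p * c = (p * p) * s"
    by (simp add: s mult.assoc)
  also have "\<dots> = c"
    using assms(1) by (simp add: idempotent_iff s)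
  finally have "is_inner_inverse c t"
    by (simp add: is_inner_inverse_def t)
  then show ?thesis ..
qed

lemma wc_ideal_imp_inner_inverse:
  assumes "wc_ideal_conditions a m p"
  shows "\<exists>x. is_inner_inverse (a ^ (m + 1)) x"
  using assms right_ideal_eq_idempotent_imp_inner_inverse unfolding wc_ideal_conditions_def by blast

text \<open>
  The candidate \<open>a^m * x * p\<close> is read off from \<open>p = a * y\<close>: as \<open>x\<close> gives the factorisation
  \<open>p = a^(m+1) * x * p\<close>, splitting off the leftmost factor \<open>a\<close> leaves the candidate.
\<close>

lemma wc_annihilator_imp_equations:
  assumes p: "wc_annihilator_conditions a m p" and x: "is_inner_inverse (a ^ (m + 1)) x"
  shows "wc_equations a (a ^ m * x * p) m" and "a * (a ^ m * x * p) = p"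
proof -
  have idem: "idempotent p" and ann: "left_annihilator p = left_annihilator (a ^ m)"
      "left_annihilator (a ^ m) = left_annihilator (a ^ (m + 1))"
    using p by (simp_all add: wc_annihilator_conditions_def)
  have pp: "is_inner_inverse p p"
    using idem by (rule idempotent_imp_inner_inverse)
  have pb: "p * a ^ m = a ^ m"
    using left_annihilator_subset_imp[OF pp, of "a ^ m"] idem ann by (simp add: idempotent_iff)
  have pc: "p * a ^ (m + 1) = a ^ (m + 1)"
    using left_annihilator_subset_imp[OF pp, of "a ^ (m + 1)"] idem ann
    by (simp add: idempotent_iff)
  have cxp: "a ^ (m + 1) * x * p = p"
    using left_annihilator_subset_imp[OF x, of p] ann by simp
  have bxc: "a ^ m * x * a ^ (m + 1) = a ^ m"
    using p by (intro right_annihilator_subset_imp[OF x]) (simp add: wc_annihilator_conditions_def)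
  have sp: "star (a ^ m) * p = star (a ^ m)"
    using right_annihilator_subset_imp[OF pp, of "star (a ^ m)"] p
    by (simp add: wc_annihilator_conditions_def idempotent_iff mult.assoc)
  define y where "y = a ^ m * x * p"
  have ay: "a * y = p"
    using cxp by (simp add: y_def mult.assoc)
  have "y * a ^ (m + 1) = a ^ m * x * (p * a ^ (m + 1))"
    by (simp only: y_def mult.assoc)
  then have 1: "y * a ^ (m + 1) = a ^ m"
    by (simp only: pc bxc)
  have "a * y ^ 2 = p * y"
    by (simp add: power2_eq_square mult.assoc[symmetric] ay)
  also have "\<dots> = y"
    by (simp add: y_def mult.assoc[symmetric] pb)
  finally have 2: "a * y ^ 2 = y" .
  have "star (a ^ m) * a * y = star (a ^ m)"
    by (simp add: mult.assoc ay sp)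
  with 1 2 show "wc_equations a (a ^ m * x * p) m"
    by (simp add: wc_equations_def y_def)
  show "a * (a ^ m * x * p) = p"
    using ay by (simp add: y_def)
qed

theorem theorem3p5:
  fixes a :: "'a::proper_star_ring" and m :: nat
  assumes "0 < m"
  shows "((weak_core_invertible a \<and> weak_core_index a \<le> m) \<longleftrightarrow>
            (\<exists>p. wc_ideal_conditions a m p)) \<and>
         ((weak_core_invertible a \<and> weak_core_index a \<le> m) \<longleftrightarrow>
            (\<exists>x. is_inner_inverse (a ^ (m + 1)) x) \<and> (\<exists>p. wc_annihilator_conditions a m p)) \<and>
         (weak_core_invertible a \<and> weak_core_index a \<le> m \<longrightarrow>
            (\<exists>p. wc_ideal_conditions a m p \<and> (\<forall>q. wc_ideal_conditions a m q \<longrightarrow> q = p) \<and>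
                 wc_annihilator_conditions a m p \<and> (\<forall>q. wc_annihilator_conditions a m q \<longrightarrow> q = p) \<and>
                 (\<forall>x x'. is_inner_inverse (a ^ (m + 1)) x \<longrightarrow> is_inner_inverse (a ^ (m + 1)) x' \<longrightarrow>
                    a ^ m * x * p = a ^ m * x' * p) \<and>
                 (\<forall>x. is_inner_inverse (a ^ (m + 1)) x \<longrightarrow>
                    weak_core_inverse a = a ^ m * x * p)))"
proof (intro conjI impI)
  let ?I = "\<exists>y. wc_equations a y m"
  let ?II = "\<exists>p. wc_ideal_conditions a m p"
  let ?III = "(\<exists>x. is_inner_inverse (a ^ (m + 1)) x) \<and> (\<exists>p. wc_annihilator_conditions a m p)"
  have "?I \<Longrightarrow> ?II"
    using wc_equations_imp_ideal by blast
  moreover have "?II \<Longrightarrow> ?III"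
    using wc_ideal_imp_annihilator wc_ideal_imp_inner_inverse by blast
  moreover have "?III \<Longrightarrow> ?I"
    using wc_annihilator_imp_equations(1) by blast
  ultimately show "(weak_core_invertible a \<and> weak_core_index a \<le> m) \<longleftrightarrow> ?II"
    and "(weak_core_invertible a \<and> weak_core_index a \<le> m) \<longleftrightarrow> ?III"
    unfolding weak_core_index_le_iff[OF assms] by blast+
next
  assume "weak_core_invertible a \<and> weak_core_index a \<le> m"
  then obtain y where y: "wc_equations a y m"
    unfolding weak_core_index_le_iff[OF assms] ..
  have ideal: "wc_ideal_conditions a m (a * y)"
    by (rule wc_equations_imp_ideal[OF y])
  then have ann: "wc_annihilator_conditions a m (a * y)"
    by (rule wc_ideal_imp_annihilator)
  have formula: "a ^ m * x * q = y"
    if "wc_annihilator_conditions a m q" "is_inner_inverse (a ^ (m + 1)) x" for q x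
    using wc_equations_unique wc_annihilator_imp_equations(1)[OF that] y by blast
  obtain x where x: "is_inner_inverse (a ^ (m + 1)) x"
    using wc_ideal_imp_inner_inverse[OF ideal] ..
  have unique: "q = a * y" if "wc_annihilator_conditions a m q" for q
    using wc_annihilator_imp_equations(2)[OF that x] formula[OF that x] by simp
  show "\<exists>p. wc_ideal_conditions a m p \<and> (\<forall>q. wc_ideal_conditions a m q \<longrightarrow> q = p) \<and>
      wc_annihilator_conditions a m p \<and> (\<forall>q. wc_annihilator_conditions a m q \<longrightarrow> q = p) \<and>
      (\<forall>x x'. is_inner_inverse (a ^ (m + 1)) x \<longrightarrow> is_inner_inverse (a ^ (m + 1)) x' \<longrightarrow>
         a ^ m * x * p = a ^ m * x' * p) \<and>
      (\<forall>x. is_inner_inverse (a ^ (m + 1)) x \<longrightarrow> weak_core_inverse a = a ^ m * x * p)"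
  proof (intro exI[of _ "a * y"] conjI allI impI ideal ann)
    show "q = a * y" if "wc_ideal_conditions a m q" for q
      by (rule unique[OF wc_ideal_imp_annihilator[OF that]])
    show "q = a * y" if "wc_annihilator_conditions a m q" for q
      by (rule unique[OF that])
    show "weak_core_inverse a = a ^ m * x * (a * y)" if "is_inner_inverse (a ^ (m + 1)) x" for x
      using formula[OF ann that] weak_core_inverse_eqI[OF assms y] by simp
    show "a ^ m * x * (a * y) = a ^ m * x' * (a * y)"
      if "is_inner_inverse (a ^ (m + 1)) x" "is_inner_inverse (a ^ (m + 1)) x'" for x x'
      using formula[OF ann that(1)] formula[OF ann that(2)] by simp
  qed
qed

end
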